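(* Let $r$ and $n$ be positive integers such that $n\ge r+1\ge 3$ and $n-r$ is even. Then $$\mathrm{S}(n,r) \ge \mathrm{N}(n,r) + \sum_{i=0}^{\frac{n-r}{2}-2}\left(\frac{n-r}{2}-i-1\right)\binom{r-2+2i}{r-3}.$$
   Context: For integers $n\ge r+1$, $r\ge 0$, an $(n,r+1,r)$-covering is a family of $(r+1)$-subsets (blocks) of $\{1,\ldots,n\}$ such that each $r$-subset of $\{1,\ldots,n\}$ is contained in at least one block; $\mathrm{C}(n,r)$ denotes the minimum number of blocks of an $(n,r+1,r)$-covering (so $\mathrm{C}(n,0)=1$). For positive integers $n\ge r+1\ge 3$ define $$\mathrm{S}(n,r) := \sum_{i=1}^{\left\lfloor\frac{n-r+1}{2}\right\rfloor}\binom{n-2i}{r-1} + \left\lfloor\frac{n-r}{2}\right\rfloor,$$ $$\mathrm{N}(n,r) := \sum_{i=0}^{\left\lceil\frac{n-r}{2}\right\rceil-1}(n-r-2i)\binom{r-2+2i}{r-2} + \left\lceil\frac{n-r}{2}\right\rceil-1 + \delta_0\,\mathrm{C}(n-2,r-2),$$ where $\delta_0=0$ if $n-r$ is odd and $\delta_0=1$ if $n-r$ is even. Conventions: $\binom{a}{b}=0$ for $b<0$, and empty sums are $0$. *)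

theory Defs
  imports Complex_Main
begin

definition is_covering :: "nat \<Rightarrow> nat \<Rightarrow> nat set set \<Rightarrow> bool" where
  "is_covering n r F \<longleftrightarrow>
     (\<forall>B\<in>F. B \<subseteq> {1..n} \<and> card B = r + 1) \<and>
     (\<forall>A. A \<subseteq> {1..n} \<and> card A = r \<longrightarrow> (\<exists>B\<in>F. A \<subseteq> B))"

text \<open>Only meaningful for \<open>n \<ge> r + 1\<close>, where coverings exist. Every covering
  is a finite set of blocks, so \<open>card\<close> really counts the blocks.\<close>

definition covering_number :: "nat \<Rightarrow> nat \<Rightarrow> nat" where
  "covering_number n r = (LEAST m. \<exists>F. is_covering n r F \<and> card F = m)"

lemma covering_number_0:
  assumes "n \<ge> 1"
  shows "covering_number n 0 = 1"
  unfolding covering_number_def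
proof (rule Least_equality)
  have "is_covering n 0 {{1}}"
    using assms by (auto simp: is_covering_def dest: finite_subset)
  then show "\<exists>F. is_covering n 0 F \<and> card F = 1"
    by (intro exI[of _ "{{1}}"]) simp
next
  fix m assume "\<exists>F. is_covering n 0 F \<and> card F = m"
  then obtain F where F: "is_covering n 0 F" "card F = m" by blast
  have "F \<subseteq> Pow {1..n}" using F(1) by (auto simp: is_covering_def)
  then have "finite F" by (rule finite_subset) simp
  moreover have "F \<noteq> {}" using F(1) by (auto simp: is_covering_def intro: exI[of _ "{}"])
  ultimately have "card F > 0" by (simp add: card_gt_0_iff)
  then show "1 \<le> m" using F(2) by simp
qed

text \<open>The lower index is an integer because \<open>r - 3\<close> is negative for \<open>r = 2\<close>, where the
  convention is that the coefficient is 0; truncated subtraction would give 1.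
  The upper index is never negative where \<open>binom\<close> is used below, so \<open>nat a\<close>
  does not truncate.\<close>

definition binom :: "int \<Rightarrow> int \<Rightarrow> int" where
  "binom a b = (if b < 0 then 0 else int (nat a choose nat b))"

definition S :: "nat \<Rightarrow> nat \<Rightarrow> int" where
  "S n r = (\<Sum>i = 1..\<lfloor>(real n - real r + 1) / 2\<rfloor>. binom (int n - 2 * i) (int r - 1))
           + \<lfloor>(real n - real r) / 2\<rfloor>"

text \<open>The natural subtractions \<open>n - r\<close>, \<open>n - 2\<close>, \<open>r - 2\<close> do not truncate for
  \<open>n \<ge> r + 1 \<ge> 3\<close>, the range in which \<open>N\<close> is used.\<close>

definition N :: "nat \<Rightarrow> nat \<Rightarrow> int" where
  "N n r = (\<Sum>i = 0..\<lceil>(real n - real r) / 2\<rceil> - 1.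
              (int n - int r - 2 * i) * binom (int r - 2 + 2 * i) (int r - 2))
           + \<lceil>(real n - real r) / 2\<rceil> - 1
           + (if even (n - r) then 1 else 0) * int (covering_number (n - 2) (r - 2))"

end

theory Submission
  imports Defs
begin

text \<open>
  Write \<open>r = s + 2\<close> and \<open>n = r + 2 * k\<close> with \<open>k \<ge> 1\<close>. The statement is an exact identity
  combined with an upper bound for the one covering number that occurs in \<open>N n r\<close>.

  The identity: by the hockey-stick rule, the \<open>j\<close>-th binomial coefficient of \<open>S n r\<close>
  (counted from the last one) is the sum of all \<open>m choose s\<close> with \<open>m < s + 2 * j + 2\<close>.
  Grouping the values of \<open>m\<close> into consecutive pairs and summing over \<open>j\<close> counts the
  \<open>i\<close>-th pair \<open>k - i\<close> times. By Pascal's rule that pair contributes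
  \<open>2 * (s + 2 * i choose s) + (s + 2 * i choose (s - 1))\<close>. The first part gives the sum in
  \<open>N n r\<close>. The second, with \<open>k - i\<close> split as \<open>(k - i - 1) + 1\<close>, gives the extra sum in the
  theorem and the remainder \<open>\<Sum>i<k. (s + 2 * i choose (s - 1))\<close>, which is 0 for \<open>s = 0\<close>
  because the lower index is then negative. This is \<open>sum_choose_decomposition\<close>.

  What is left to show is that the covering number of \<open>s + 2 * k\<close> points and \<open>s\<close>-subsets
  is at most one more than this remainder. The bound \<open>covering_number_upper_bound\<close> holds
  because a covering survives the addition of two points \<open>x\<close> and \<open>y\<close> to the ground set when
  all sets \<open>B \<union> {x, y}\<close> are added to it, for \<open>B\<close> an \<open>(s - 1)\<close>-subset of the old points.
\<close>

section \<open>Binomial sums\<close>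

lemma binom_of_nat [simp]: "binom (int m) (int j) = int (m choose j)"
  by (simp add: binom_def)

lemma binom_Pascal: "binom (int m) (int s - 1) + int (m choose s) = int (Suc m choose s)"
proof (cases s)
  case 0
  then show ?thesis by (simp add: binom_def)
next
  case (Suc t)
  then have "int s - 1 = int t" by simp
  then have "binom (int m) (int s - 1) = int (m choose t)"
    by (simp only: binom_of_nat)
  then show ?thesis using Suc by simp
qed

text \<open>The hockey-stick rule with its terms taken in consecutive pairs.\<close>

lemma choose_eq_sum_pairs:
  "(s + 2 + 2 * j) choose (s + 1) =
     (\<Sum>i<Suc j. ((s + 2 * i) choose s) + ((s + 2 * i + 1) choose s))"
proof (induction j)
  case 0
  then show ?case by simp
next
  case (Suc j)
  have "(s + 2 + 2 * Suc j) choose (s + 1) =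
      ((s + 2 + 2 * j) choose (s + 1)) + ((s + 2 * Suc j) choose s)
        + ((s + 2 * Suc j + 1) choose s)"
    by simp
  with Suc show ?case by simp
qed

lemma sum_partial_sums:
  fixes f :: "nat \<Rightarrow> int"
  shows "(\<Sum>j<k. \<Sum>i<Suc j. f i) = (\<Sum>i<k. (int k - int i) * f i)"
proof (induction k)
  case 0
  then show ?case by simp
next
  case (Suc k)
  have "(\<Sum>i<Suc k. (int (Suc k) - int i) * f i) =
      (\<Sum>i<Suc k. (int k - int i) * f i) + (\<Sum>i<Suc k. f i)"
    unfolding sum.distrib [symmetric] by (rule sum.cong) (auto simp: algebra_simps)
  with Suc show ?case by simp
qed

lemma sum_choose_decomposition:
  "(\<Sum>j<k. int ((s + 2 + 2 * j) choose (s + 1))) =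
     (\<Sum>i<k. (2 * int k - 2 * int i) * int ((s + 2 * i) choose s))
     + (\<Sum>i<k. (int k - int i - 1) * binom (int (s + 2 * i)) (int s - 1))
     + (\<Sum>i<k. binom (int (s + 2 * i)) (int s - 1))"
proof -
  define c where "c i = int ((s + 2 * i) choose s)" for i
  define b where "b i = binom (int (s + 2 * i)) (int s - 1)" for i
  have pair: "int ((s + 2 * i + 1) choose s) = b i + c i" for i
    using binom_Pascal [of "s + 2 * i" s] by (simp add: b_def c_def)
  have "int ((s + 2 + 2 * j) choose (s + 1)) = (\<Sum>i<Suc j. 2 * c i + b i)" for j
    unfolding choose_eq_sum_pairs of_nat_sum of_nat_add pair
    by (simp add: c_def)
  then have "(\<Sum>j<k. int ((s + 2 + 2 * j) choose (s + 1))) =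
      (\<Sum>i<k. (int k - int i) * (2 * c i + b i))"
    by (simp only: sum_partial_sums)
  also have "\<dots> = (\<Sum>i<k. (2 * int k - 2 * int i) * c i)
      + (\<Sum>i<k. (int k - int i - 1) * b i) + (\<Sum>i<k. b i)"
    unfolding sum.distrib [symmetric] by (rule sum.cong) (auto simp: algebra_simps)
  finally show ?thesis by (simp add: b_def c_def)
qed

section \<open>An upper bound for the covering number\<close>

text \<open>The condition \<open>card B + 1 = s\<close> stands for \<open>card B = s - 1\<close>, and it leaves no such \<open>B\<close>
  for \<open>s = 0\<close>, in agreement with the convention for \<open>binom\<close>.\<close>

lemma card_subsets_pred:
  "int (card {B. B \<subseteq> {1..m} \<and> card B + 1 = s}) = binom (int m) (int s - 1)"
proof (cases s)
  case 0
  then show ?thesis by (simp add: binom_def)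
next
  case (Suc t)
  then have "int s - 1 = int t" by simp
  then have "binom (int m) (int s - 1) = int (m choose t)"
    by (simp only: binom_of_nat)
  then show ?thesis using Suc n_subsets [of "{1..m}" t] by simp
qed

text \<open>An \<open>s\<close>-subset of the larger ground set either avoids both new points, and is then
  covered by \<open>F\<close>, or has at most \<open>s - 1\<close> old points, which can be filled up to an
  \<open>(s - 1)\<close>-subset. The blocks of \<open>F\<close> may themselves use the new points. This freedom
  provides the start of the induction below, where \<open>m = s\<close> is too small for a covering.\<close>

lemma is_covering_add_two_points:
  assumes blocks: "\<And>B. B \<in> F \<Longrightarrow> B \<subseteq> {1..m + 2} \<and> card B = s + 1"
    and covers: "\<And>A. A \<subseteq> {1..m} \<Longrightarrow> card A = s \<Longrightarrow> \<exists>B\<in>F. A \<subseteq> B"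
    and "s \<le> m"
  shows "is_covering (m + 2) s
    (F \<union> (\<lambda>B. B \<union> {m + 1, m + 2}) ` {B. B \<subseteq> {1..m} \<and> card B + 1 = s})"
    (is "is_covering _ _ (F \<union> ?h ` ?P)")
  unfolding is_covering_def
proof (intro conjI ballI allI impI)
  fix B assume B: "B \<in> F \<union> ?h ` ?P"
  have "C \<union> {m + 1, m + 2} \<subseteq> {1..m + 2} \<and> card (C \<union> {m + 1, m + 2}) = s + 1"
    if C: "C \<subseteq> {1..m}" "card C + 1 = s" for C
  proof -
    have "finite C" using C(1) by (rule finite_subset) simp
    moreover have "C \<inter> {m + 1, m + 2} = {}" using C(1) by auto
    ultimately have "card (C \<union> {m + 1, m + 2}) = card C + 2"
      by (simp add: card_Un_disjoint)
    then show ?thesis using C by auto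
  qed
  then show "B \<subseteq> {1..m + 2}" "card B = s + 1"
    using B blocks by blast+
next
  fix A assume A: "A \<subseteq> {1..m + 2} \<and> card A = s"
  show "\<exists>B\<in>F \<union> ?h ` ?P. A \<subseteq> B"
  proof (cases "A \<subseteq> {1..m}")
    case True
    then obtain B where "B \<in> F" "A \<subseteq> B" using covers [OF True] A by blast
    then show ?thesis by (intro bexI [of _ B] UnI1)
  next
    case False
    let ?A = "A \<inter> {1..m}"
    have fin: "finite A" using A finite_subset by blast
    have "card ?A < card A" using False fin by (intro psubset_card_mono) auto
    then have le: "card ?A \<le> s - 1" and "0 < s" using A by auto
    moreover have "s - 1 \<le> card {1..m}" using \<open>s \<le> m\<close> by simp
    ultimately obtain B where B: "?A \<subseteq> B" "B \<subseteq> {1..m}" "card B = s - 1"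
      using exists_subset_between [of ?A "s - 1" "{1..m}"] by auto
    have "A \<subseteq> B \<union> {m + 1, m + 2}"
    proof
      fix x assume "x \<in> A"
      then have "x \<in> ?A \<or> x = m + 1 \<or> x = m + 2" using A by force
      then show "x \<in> B \<union> {m + 1, m + 2}" using B(1) by blast
    qed
    moreover have "B \<in> ?P" using B \<open>0 < s\<close> by simp
    ultimately show ?thesis by (intro bexI [of _ "?h B"] UnI2 imageI)
  qed
qed

lemma card_Un_new_blocks:
  "int (card (F \<union> h ` {B. B \<subseteq> {1..m} \<and> card B + 1 = s}))
     \<le> int (card F) + binom (int m) (int s - 1)"
proof -
  let ?P = "{B. B \<subseteq> {1..m} \<and> card B + 1 = s}"
  have "finite ?P" by simp
  then have "card (F \<union> h ` ?P) \<le> card F + card ?P"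
    by (meson add_left_mono card_Un_le card_image_le order_trans)
  then show ?thesis using card_subsets_pred [of m s] by linarith
qed

lemma ex_small_covering:
  "\<exists>F. is_covering (s + 2 * Suc k) s F \<and>
     int (card F) \<le> 1 + (\<Sum>i<Suc k. binom (int (s + 2 * i)) (int s - 1))"
proof (induction k)
  case 0
  let ?F = "{{1..s + 1}}"
  let ?G = "?F \<union> (\<lambda>B. B \<union> {s + 1, s + 2}) ` {B. B \<subseteq> {1..s} \<and> card B + 1 = s}"
  have "is_covering (s + 2) s ?G"
    by (rule is_covering_add_two_points) auto
  moreover have "int (card ?G) \<le> 1 + binom (int s) (int s - 1)"
    using card_Un_new_blocks [of ?F] by simp
  ultimately show ?case by (intro exI [of _ ?G]) simp
next
  case (Suc k)
  let ?m = "s + 2 * Suc k"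
  from Suc obtain F where F: "is_covering ?m s F"
    and card: "int (card F) \<le> 1 + (\<Sum>i<Suc k. binom (int (s + 2 * i)) (int s - 1))"
    by blast
  let ?G = "F \<union> (\<lambda>B. B \<union> {?m + 1, ?m + 2}) ` {B. B \<subseteq> {1..?m} \<and> card B + 1 = s}"
  have "is_covering (?m + 2) s ?G"
  proof (rule is_covering_add_two_points)
    show "B \<subseteq> {1..?m + 2} \<and> card B = s + 1" if "B \<in> F" for B
      using F that unfolding is_covering_def by fastforce
    show "\<exists>B\<in>F. A \<subseteq> B" if "A \<subseteq> {1..?m}" "card A = s" for A
      using F that unfolding is_covering_def by blast
  qed simp
  moreover have eq: "s + 2 * Suc (Suc k) = ?m + 2" by simp
  moreover have "int (card ?G) \<le> 1 + (\<Sum>i<Suc (Suc k). binom (int (s + 2 * i)) (int s - 1))"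
    using card_Un_new_blocks [of F _ ?m s] card
    unfolding sum.lessThan_Suc [of _ "Suc k"] by (smt (verit))
  ultimately show ?case unfolding eq by blast
qed

lemma covering_number_upper_bound:
  assumes "0 < k"
  shows "int (covering_number (s + 2 * k) s)
    \<le> 1 + (\<Sum>i<k. binom (int (s + 2 * i)) (int s - 1))"
proof -
  obtain k' where k: "k = Suc k'" using assms gr0_conv_Suc by blast
  obtain F where F: "is_covering (s + 2 * k) s F"
    and card: "int (card F) \<le> 1 + (\<Sum>i<k. binom (int (s + 2 * i)) (int s - 1))"
    using ex_small_covering [of s k'] unfolding k by blast
  have "covering_number (s + 2 * k) s \<le> card F"
    unfolding covering_number_def by (rule Least_le) (use F in blast)
  with card show ?thesis by linarith
qed

section \<open>The quantities S and N\<close>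

lemma sum_int_interval:
  fixes f :: "int \<Rightarrow> int"
  shows "(\<Sum>i = 0..int k - 1. f i) = (\<Sum>i<k. f (int i))"
  by (rule sum.reindex_bij_witness [of _ int nat]) auto

lemma S_eq:
  "S (s + 2 + 2 * k) (s + 2) = (\<Sum>j<k. int ((s + 2 + 2 * j) choose (s + 1))) + int k"
proof -
  have upper: "\<lfloor>(real (s + 2 + 2 * k) - real (s + 2) + 1) / 2\<rfloor> = int k"
    by (rule floor_unique) auto
  have "(\<Sum>i = 1..int k. binom (int (s + 2 + 2 * k) - 2 * i) (int (s + 2) - 1)) =
      (\<Sum>j<k. int ((s + 2 + 2 * j) choose (s + 1)))"
  proof (rule sum.reindex_bij_witness [of _ "\<lambda>j. int k - int j" "\<lambda>i. nat (int k - i)"])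
    fix i assume i: "i \<in> {1..int k}"
    then have "int (s + 2 + 2 * k) - 2 * i = int (s + 2 + 2 * nat (int k - i))"
      by simp
    moreover have "int (s + 2) - 1 = int (s + 1)" by simp
    ultimately show "int ((s + 2 + 2 * nat (int k - i)) choose (s + 1)) =
        binom (int (s + 2 + 2 * k) - 2 * i) (int (s + 2) - 1)"
      by (simp only: binom_of_nat)
  qed auto
  then show ?thesis unfolding S_def upper by simp
qed

lemma N_eq:
  "N (s + 2 + 2 * k) (s + 2) =
     (\<Sum>i<k. (2 * int k - 2 * int i) * int ((s + 2 * i) choose s))
     + int k - 1 + int (covering_number (s + 2 * k) s)"
proof -
  have upper: "\<lceil>(real (s + 2 + 2 * k) - real (s + 2)) / 2\<rceil> = int k"
    by simp
  have "binom (int (s + 2) - 2 + 2 * int i) (int (s + 2) - 2) = int ((s + 2 * i) choose s)" for i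
    using binom_of_nat [of "s + 2 * i" s] by simp
  then show ?thesis unfolding N_def upper sum_int_interval by simp
qed

text \<open>The summation range is extended by the index \<open>k - 1\<close>, whose coefficient is 0.\<close>

lemma extra_sum_eq:
  assumes "0 < k"
  shows "(\<Sum>i = 0..int k - 2. (int k - i - 1) * binom (int s + 2 * i) (int s - 1)) =
    (\<Sum>i<k. (int k - int i - 1) * binom (int (s + 2 * i)) (int s - 1))"
proof -
  obtain k' where k: "k = Suc k'" using assms gr0_conv_Suc by blast
  then have "int k - 2 = int k' - 1" by simp
  then show ?thesis by (simp add: sum_int_interval k)
qed

theorem theorem4p8:
  fixes r n :: nat
  assumes "r > 0" and "n > 0"
    and "n \<ge> r + 1" and "r + 1 \<ge> 3"
    and "even (n - r)"
  shows "S n r \<ge> N n r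
    + (\<Sum>i = 0..(int n - int r) div 2 - 2.
         ((int n - int r) div 2 - i - 1) * binom (int r - 2 + 2 * i) (int r - 3))"
proof -
  define s where "s = r - 2"
  obtain k where "n - r = 2 * k" using assms(5) by blast
  then have r: "r = s + 2" and n: "n = s + 2 + 2 * k" and "0 < k"
    using assms unfolding s_def by auto
  have half: "(int n - int r) div 2 = int k" and indices: "int r - 2 = int s" "int r - 3 = int s - 1"
    by (simp_all add: r n)
  show ?thesis
    unfolding half indices extra_sum_eq [OF \<open>0 < k\<close>]
    unfolding r n S_eq N_eq sum_choose_decomposition
    using covering_number_upper_bound [OF \<open>0 < k\<close>, of s] by linarith
qed

end
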